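(* Let $F$ be a semipairwise disjoint family of at least $6$ nonempty open convex sets in $\mathbb{R}^2$. Suppose that for every subfamily $F'\subset F$ of size $5$, $T_1(F')\neq\varnothing$, and that for every subfamily $F'\subset F$ of size $4$, $T_1(F')$ is connected. Then $T_1(F)\neq\varnothing$.
   Context: A family $F$ of sets is called semipairwise disjoint if, given any three elements of $F$, two of them are disjoint. Let $G(n,d)$ be the Grassmannian of $n$-dimensional linear subspaces of $\mathbb{R}^d$, and let $M(n,d)$ be the space of all affine $n$-planes in $\mathbb{R}^d$, topologized as an open subset of $G(n+1,d+1)$ (identify $\mathbb{R}^d$ with the affine hyperplane $\mathbb{R}^d\times\{1\}\subset\mathbb{R}^{d+1}$ and send an affine $n$-plane to its linear span). For a family $F$ of nonempty convex sets in $\mathbb{R}^d$ and $0\le n<d$, $T_n(F)\subset M(n,d)$ is the subspace of all affine $n$-planes that intersect every member of $F$; thus $T_1(F)$ here is the space of lines in $\mathbb{R}^2$ meeting all members of $F$. A space $U$ is called connected if $H_0(U)=0$, where $H_*$ is reduced singular homology with coefficients in a fixed nonzero abelian group.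
   Formalization: The family F is assumed finite; for infinite families the claim fails, e.g. for the open discs of radius 1/(4n) centred at (n, 1/(4n)), n ≥ 1, where every finite subfamily has transversals but no line meets all. *)

theory Defs
  imports "HOL-Homology.Homology"
begin

definition semipairwise_disjoint :: "'a set set \<Rightarrow> bool" where
  "semipairwise_disjoint F \<longleftrightarrow>
     (\<forall>A\<in>F. \<forall>B\<in>F. \<forall>C\<in>F. A \<noteq> B \<and> A \<noteq> C \<and> B \<noteq> C \<longrightarrow>
        A \<inter> B = {} \<or> A \<inter> C = {} \<or> B \<inter> C = {})"

definition frame_topology :: "nat \<Rightarrow> (nat \<Rightarrow> 'a::euclidean_space) topology" where
  "frame_topology n =
     subtopology (product_topology (\<lambda>_. euclidean) {..<n})
       {v. inj_on v {..<n} \<and> independent (v ` {..<n})}"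

definition grassmannian :: "nat \<Rightarrow> 'a::euclidean_space set set" where
  "grassmannian n = {V. subspace V \<and> dim V = n}"

text \<open>The Grassmannian carries the quotient topology with respect to the map that sends an
  \<open>n\<close>-frame (a linearly independent \<open>n\<close>-tuple of vectors) to its linear span.\<close>

definition grassmannian_topology :: "nat \<Rightarrow> 'a::euclidean_space set topology" where
  "grassmannian_topology n =
     topology (\<lambda>U. U \<subseteq> grassmannian n \<and>
       openin (frame_topology n) {v \<in> topspace (frame_topology n). span (v ` {..<n}) \<in> U})"

lemma openin_grassmannian_topology:
  fixes U :: "'a::euclidean_space set set"
  shows "openin (grassmannian_topology n) U \<longleftrightarrow> U \<subseteq> grassmannian n \<and>
     openin (frame_topology n) {v \<in> topspace (frame_topology n). span (v ` {..<n}) \<in> U}"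
proof -
  have "istopology (\<lambda>U :: 'a set set. U \<subseteq> grassmannian n \<and>
     openin (frame_topology n) {v \<in> topspace (frame_topology n). span (v ` {..<n}) \<in> U})"
    (is "istopology (\<lambda>U. _ \<and> openin _ (?P U))")
    unfolding istopology_def
  proof (intro conjI allI impI; (elim conjE)?)
    fix S T :: "'a set set"
    assume S: "S \<subseteq> grassmannian n" "openin (frame_topology n) (?P S)"
      and T: "T \<subseteq> grassmannian n" "openin (frame_topology n) (?P T)"
    show "S \<inter> T \<subseteq> grassmannian n" using S by blast
    have "?P (S \<inter> T) = ?P S \<inter> ?P T" by blast
    then show "openin (frame_topology n) (?P (S \<inter> T))"
      using S T by (simp only: openin_Int)
  next
    fix K :: "'a set set set"
    assume K: "\<forall>S\<in>K. S \<subseteq> grassmannian n \<and> openin (frame_topology n) (?P S)"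
    then show "\<Union>K \<subseteq> grassmannian n" by blast
    have "?P (\<Union>K) = (\<Union>S\<in>K. ?P S)" by blast
    moreover have "openin (frame_topology n) (\<Union>S\<in>K. ?P S)"
      using K by (intro openin_Union) blast
    ultimately show "openin (frame_topology n) (?P (\<Union>K))" by (simp only:)
  qed
  then show ?thesis
    by (simp add: grassmannian_topology_def topology_inverse')
qed

definition affine_planes :: "nat \<Rightarrow> 'a::euclidean_space set set" where
  "affine_planes n = {P. affine P \<and> aff_dim P = int n}"

text \<open>An affine \<open>n\<close>-plane \<open>P\<close> is identified with the linear span of \<open>P \<times> {1}\<close>,
  an \<open>(n + 1)\<close>-dimensional linear subspace of the product of the ambient space with
  the real line. This map is injective, so the pullback topology is the subspace topology.\<close>

definition plane_span :: "'a::euclidean_space set \<Rightarrow> ('a \<times> real) set" where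
  "plane_span P = span (P \<times> {1})"

definition affine_planes_topology :: "nat \<Rightarrow> 'a::euclidean_space set topology" where
  "affine_planes_topology n =
     pullback_topology (affine_planes n) plane_span (grassmannian_topology (Suc n))"

definition transversals :: "nat \<Rightarrow> 'a::euclidean_space set set \<Rightarrow> 'a set set" where
  "transversals n F = {P \<in> affine_planes n. \<forall>A\<in>F. P \<inter> A \<noteq> {}}"

definition transversal_space :: "nat \<Rightarrow> 'a::euclidean_space set set \<Rightarrow> 'a set topology" where
  "transversal_space n F = subtopology (affine_planes_topology n) (transversals n F)"

text \<open>The library provides singular homology with integer coefficients only. Here the
  coefficients are taken in an arbitrary abelian group, given as a type; a chain is a finitely
  supported function from singular simplices to coefficients.\<close>

type_synonym ('a, 'g) coeff_chain = "((nat \<Rightarrow> real) \<Rightarrow> 'a) \<Rightarrow>\<^sub>0 'g"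

definition coeff_chains :: "nat \<Rightarrow> 'a topology \<Rightarrow> ('a, 'g::ab_group_add) coeff_chain set" where
  "coeff_chains p X = {c. Poly_Mapping.keys c \<subseteq> singular_simplex_set p X}"

definition coeff_boundary ::
    "nat \<Rightarrow> ('a, 'g::ab_group_add) coeff_chain \<Rightarrow> ('a, 'g) coeff_chain" where
  "coeff_boundary p c =
     (\<Sum>f\<in>Poly_Mapping.keys c. \<Sum>k\<le>p.
        Poly_Mapping.single (singular_face p k f)
          (if even k then Poly_Mapping.lookup c f else - Poly_Mapping.lookup c f))"

definition augmentation :: "('a, 'g::ab_group_add) coeff_chain \<Rightarrow> 'g" where
  "augmentation c = (\<Sum>f\<in>Poly_Mapping.keys c. Poly_Mapping.lookup c f)"

text \<open>In degree 0 the augmented complex has the augmentation as its differential.\<close>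

definition reduced_cycles :: "nat \<Rightarrow> 'a topology \<Rightarrow> ('a, 'g::ab_group_add) coeff_chain set" where
  "reduced_cycles p X =
     {c \<in> coeff_chains p X. if p = 0 then augmentation c = 0 else coeff_boundary p c = 0}"

definition coeff_boundaries :: "nat \<Rightarrow> 'a topology \<Rightarrow> ('a, 'g::ab_group_add) coeff_chain set" where
  "coeff_boundaries p X = coeff_boundary (Suc p) ` coeff_chains (Suc p) X"

definition reduced_cycle_group ::
    "nat \<Rightarrow> 'a topology \<Rightarrow> ('a, 'g::ab_group_add) coeff_chain monoid" where
  "reduced_cycle_group p X = \<lparr>carrier = reduced_cycles p X, monoid.mult = (+), one = 0\<rparr>"

definition reduced_homology_group_coeff ::
    "'g::ab_group_add itself \<Rightarrow> nat \<Rightarrow> 'a topology \<Rightarrow> ('a, 'g) coeff_chain set monoid" where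
  "reduced_homology_group_coeff _ p X = reduced_cycle_group p X Mod coeff_boundaries p X"

definition homology_connected :: "'g::ab_group_add itself \<Rightarrow> 'a topology \<Rightarrow> bool" where
  "homology_connected G X \<longleftrightarrow> trivial_group (reduced_homology_group_coeff G 0 X)"

end

theory Submission
  imports Defs "HOL-Analysis.Cartesian_Euclidean_Space"
begin

text \<open>
  By Helly's theorem on the line, \<open>F\<close> has a transversal in direction \<open>u\<close> iff the projections
  along \<open>u\<close> of any two members meet, so everything happens in the set \<open>D(S)\<close> of transversal
  directions of \<open>S\<close>, a subset of the projective line. Connectedness of the transversal space of
  a four-element \<open>T\<close> says that two directions outside \<open>D(T)\<close> never separate two
  directions in \<open>D(T)\<close>. This passes to every \<open>S\<close> with at least four members, since two
  directions outside \<open>D(S)\<close> are already excluded by two pairs, that is, by at most four members.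

  The theorem follows by induction on \<open>|S|\<close>. Choose \<open>p\<^sub>A \<in> D(S - {A})\<close> for each \<open>A\<close>, and let \<open>v A\<close>
  be the set of those \<open>B\<close> whose projection misses that of \<open>A\<close> along \<open>p\<^sub>A\<close>. Given three members
  \<open>A, B, C\<close>, the remaining ones contain a disjoint pair, hence miss a direction, and removing it
  orders \<open>p\<^sub>A, p\<^sub>B, p\<^sub>C\<close> linearly; if \<open>p\<^sub>B\<close> is the middle one then \<open>p\<^sub>B \<in> D(S - {A, C})\<close>, so
  \<open>v B \<subseteq> {A, C}\<close>. If \<open>D(S)\<close> is empty, all \<open>v A\<close> are nonempty, and a count on six members forces
  \<open>v A = {B}\<close>, \<open>v B = {C}\<close>, \<open>v C = {A}\<close> for some triple, which contradicts the order of its three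
  directions.
\<close>

subsection \<open>Reduced homology in degree zero\<close>

lemma coeff_chain_sum_eq:
  fixes c :: "('a, 'g::ab_group_add) coeff_chain"
  assumes "finite K" "Poly_Mapping.keys c \<subseteq> K"
  shows "(\<Sum>f\<in>Poly_Mapping.keys c. if Q f then Poly_Mapping.lookup c f else 0) = (\<Sum>f\<in>K. if Q f then Poly_Mapping.lookup c f else 0)"
  using assms by (intro sum.mono_neutral_left) (auto simp: in_keys_iff)

text \<open>For a separation into open \<open>E1\<close> and \<open>E2\<close>, the functional
  \<open>\<phi>\<close> that adds up the coefficients of the points in \<open>E1\<close> kills
  boundaries, because a singular 1-simplex has connected image. It takes the value \<open>g\<close>
  on the reduced cycle g x - g y, which is therefore not a boundary.\<close>

lemma homology_connected_imp_connected_space: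
  fixes X :: "'a topology"
  assumes coef: "\<exists>g :: 'g::ab_group_add. g \<noteq> 0"
    and conn: "homology_connected TYPE('g) X"
  shows "connected_space X"
proof (rule ccontr)
  assume "\<not> connected_space X"
  then obtain E1 E2 where E: "openin X E1" "openin X E2" "topspace X \<subseteq> E1 \<union> E2" "E1 \<inter> E2 = {}"
      "E1 \<noteq> {}" "E2 \<noteq> {}"
    unfolding connected_space_def by blast
  obtain x y where xy: "x \<in> E1" "y \<in> E2" using E by blast
  obtain g :: 'g where g: "g \<noteq> 0" using coef by blast
  define P where "P z = (restrict (\<lambda>_. z) (standard_simplex 0) :: (nat \<Rightarrow> real) \<Rightarrow> 'a)" for z
  have xt: "x \<in> topspace X" "y \<in> topspace X" using E xy openin_subset by blast+
  \<comment> \<open>The only point of the standard 0-simplex; evaluation there recovers the point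
    that a singular 0-simplex names.\<close>
  define vtx where "vtx = (\<lambda>j::nat. if j = 0 then 1 else (0::real))"
  have vtx: "vtx \<in> standard_simplex 0" by (simp add: vtx_def standard_simplex_0)
  have Px: "P z vtx = z" for z using vtx by (simp add: P_def)
  have Pxy: "P x \<noteq> P y" using Px xy E by (metis disjoint_iff)
  define \<phi> where "\<phi> c = (\<Sum>f\<in>Poly_Mapping.keys c. if f vtx \<in> E1 then Poly_Mapping.lookup c f else 0)"
    for c :: "('a, 'g) coeff_chain"
  have \<phi>_add: "\<phi> (c + d) = \<phi> c + \<phi> d" for c d
  proof -
    let ?K = "Poly_Mapping.keys c \<union> Poly_Mapping.keys d"
    let ?s = "\<lambda>c. \<Sum>f\<in>?K. if f vtx \<in> E1 then Poly_Mapping.lookup c f else 0"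
    have "\<phi> a = ?s a" if "Poly_Mapping.keys a \<subseteq> ?K" for a
      unfolding \<phi>_def using that by (intro coeff_chain_sum_eq) simp_all
    then have "\<phi> (c + d) = ?s (c + d)" "\<phi> c = ?s c" "\<phi> d = ?s d"
      using keys_add[of c d] by auto
    moreover have "?s (c + d) = ?s c + ?s d"
      by (auto simp: lookup_add simp flip: sum.distrib intro!: sum.cong)
    ultimately show ?thesis by simp
  qed
  have \<phi>0: "\<phi> 0 = 0" by (simp add: \<phi>_def)
  have \<phi>_sum: "\<phi> (sum h A) = (\<Sum>a\<in>A. \<phi> (h a))" for h and A :: "'b set"
    by (induction A rule: infinite_finite_induct) (auto simp: \<phi>0 \<phi>_add)
  have \<phi>_single: "\<phi> (Poly_Mapping.single f a) = (if f vtx \<in> E1 then a else 0)" for f a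
    by (cases "a = 0") (auto simp: \<phi>_def)
  have face: "singular_face 1 0 f vtx \<in> E1 \<longleftrightarrow> singular_face 1 1 f vtx \<in> E1"
    if f: "singular_simplex 1 X f" for f
  proof -
    have cf: "continuous_map (subtopology (powertop_real UNIV) (standard_simplex 1)) X f"
      using f by (simp add: singular_simplex_def)
    have con: "connectedin X (f ` standard_simplex 1)"
      using connectedin_continuous_map_image[OF cf] connectedin_standard_simplex[of 1]
      by (simp add: connectedin_subtopology)
    have im: "singular_face 1 k f vtx \<in> f ` standard_simplex 1" if "k \<le> 1" for k
      using simplical_face_in_standard_simplex[of 1 k vtx] vtx that
      by (simp add: singular_face_def)
    have sub: "f ` standard_simplex 1 \<subseteq> E1 \<union> E2"
      using con connectedin_subset_topspace E(3) by blast
    then have "f ` standard_simplex 1 \<inter> E1 = {} \<or> f ` standard_simplex 1 \<inter> E2 = {}"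
      using con E(1,2,4) unfolding connectedin by blast
    then show ?thesis using im[of 0] im[of 1] E(4) sub by auto
  qed
  have bd: "\<phi> (coeff_boundary 1 d) = 0" if d: "d \<in> coeff_chains 1 X" for d
  proof -
    have "\<phi> (coeff_boundary 1 d) = (\<Sum>f\<in>Poly_Mapping.keys d. 0)"
      unfolding coeff_boundary_def \<phi>_sum
    proof (rule sum.cong)
      fix f assume "f \<in> Poly_Mapping.keys d"
      then have "singular_simplex 1 X f" using d by (auto simp: coeff_chains_def)
      from face[OF this]
      show "(\<Sum>k\<le>1. \<phi> (Poly_Mapping.single (singular_face 1 k f)
              (if even k then Poly_Mapping.lookup d f else - Poly_Mapping.lookup d f))) = 0"
        by (simp add: \<phi>_single)
    qed simp
    then show ?thesis by simp
  qed
  define c where "c = Poly_Mapping.single (P x) g - Poly_Mapping.single (P y) g"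
  have keys: "Poly_Mapping.keys c = {P x, P y}"
    using Pxy g by (auto simp: c_def in_keys_iff lookup_minus lookup_single when_def split: if_splits)
  have "P z \<in> singular_simplex_set 0 X" if "z \<in> topspace X" for z
    using that by (simp add: P_def singular_simplex_def)
  then have "c \<in> coeff_chains 0 X" using keys xt by (simp add: coeff_chains_def)
  moreover have "augmentation c = 0"
    using Pxy keys by (simp add: augmentation_def c_def lookup_minus lookup_single when_def)
  ultimately have cyc: "c \<in> reduced_cycles 0 X" by (simp add: reduced_cycles_def)
  let ?G = "reduced_cycle_group 0 X :: ('a, 'g) coeff_chain monoid"
  let ?B = "coeff_boundaries 0 X :: ('a, 'g) coeff_chain set"
  \<comment> \<open>The quotient has a single coset, so the coset of \<open>c\<close> is the group
    of boundaries itself, and \<open>0 \<in> ?B\<close> puts \<open>c\<close> into it.\<close>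
  have "carrier (?G Mod ?B) = {\<one>\<^bsub>?G Mod ?B\<^esub>}"
    using conn by (simp add: homology_connected_def reduced_homology_group_coeff_def trivial_group_def)
  then have rc: "rcosets\<^bsub>?G\<^esub> ?B = {?B}" by (simp add: FactGroup_def)
  have "?B #>\<^bsub>?G\<^esub> c \<in> rcosets\<^bsub>?G\<^esub> ?B"
    using cyc by (auto simp: RCOSETS_def reduced_cycle_group_def)
  then have eq: "?B #>\<^bsub>?G\<^esub> c = ?B" using rc by blast
  have "0 \<in> ?B"
    unfolding coeff_boundaries_def coeff_boundary_def coeff_chains_def
    by (rule image_eqI[of _ _ 0]) auto
  then have "c \<in> ?B #>\<^bsub>?G\<^esub> c"
    by (auto simp: r_coset_def reduced_cycle_group_def intro!: bexI[of _ 0])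
  then obtain d where "d \<in> coeff_chains 1 X" "c = coeff_boundary 1 d"
    using eq by (auto simp: coeff_boundaries_def)
  then have "\<phi> c = 0" using bd by simp
  moreover have "\<phi> (Poly_Mapping.single (P x) g) = \<phi> c + \<phi> (Poly_Mapping.single (P y) g)"
    unfolding \<phi>_add[symmetric] c_def by simp
  moreover have "y \<notin> E1" using xy E(4) by blast
  ultimately have "g = 0" using xy by (simp add: \<phi>_single Px)
  then show False using g by simp
qed

subsection \<open>Transversal lines and their directions\<close>

definition cross2 :: "real^2 \<Rightarrow> real^2 \<Rightarrow> real" where
  "cross2 u v = u$1 * v$2 - u$2 * v$1"

text \<open>A normal of the lines in direction \<open>u\<close>, so that
  \<open>rot u \<bullet> x\<close> is a coordinate for the projection of \<open>x\<close> along
  \<open>u\<close>.\<close>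

definition rot :: "real^2 \<Rightarrow> real^2" where
  "rot u = vector [u$2, - (u$1)]"

lemma rot_nth [simp]: "rot u $ 1 = u $ 2" "rot u $ 2 = - (u $ 1)"
  by (simp_all add: rot_def)

lemma eq_2_iff: "u = v \<longleftrightarrow> u$1 = v$1 \<and> u$2 = v$2" for u v :: "real^2"
  by (simp add: vec_eq_iff forall_2)

lemma inner_2: "u \<bullet> v = u$1 * v$1 + u$2 * v$2" for u v :: "real^2"
  by (simp add: inner_vec_def sum_2)

lemma rot_eq_0_iff [simp]: "rot u = 0 \<longleftrightarrow> u = 0"
  by (auto simp: eq_2_iff)

lemma inner_rot: "rot u \<bullet> x = cross2 x u"
  by (simp add: inner_2 cross2_def)

lemma cross2_scaleR [simp]: "cross2 (c *\<^sub>R u) v = c * cross2 u v" "cross2 u (c *\<^sub>R v) = c * cross2 u v"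
  by (simp_all add: cross2_def algebra_simps)

lemma cross2_diff: "cross2 (u - v) w = cross2 u w - cross2 v w"
  by (simp add: cross2_def algebra_simps)

lemma cross2_eq_0_imp_scaleR:
  assumes "cross2 u v = 0" "u \<noteq> 0"
  obtains c where "v = c *\<^sub>R u"
proof (cases "u$1 = 0")
  case True
  then have "u$2 \<noteq> 0" using assms(2) by (auto simp: eq_2_iff)
  then have "v = (v$2 / u$2) *\<^sub>R u" using assms True by (auto simp: eq_2_iff cross2_def)
  then show ?thesis using that by blast
next
  case False
  then have "v = (v$1 / u$1) *\<^sub>R u" using assms by (auto simp: eq_2_iff cross2_def field_simps)
  then show ?thesis using that by blast
qed

lemma orthogonal_to_both_imp_cross2_0:
  assumes "a \<noteq> 0" "a \<bullet> u = 0" "a \<bullet> v = 0"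
  shows "cross2 u v = 0"
proof -
  have "a$1 * cross2 u v = (a \<bullet> u) * v$2 - (a \<bullet> v) * u$2"
       "a$2 * cross2 u v = (a \<bullet> v) * u$1 - (a \<bullet> u) * v$1"
    by (simp_all add: inner_2 cross2_def algebra_simps)
  then show ?thesis using assms by (auto simp: eq_2_iff)
qed

text \<open>A nonzero vector stands for a point of the projective line, and
  \<open>cross2 (a - b) u = 0\<close> says that \<open>a\<close> and \<open>b\<close> have the same
  projection along \<open>u\<close>. Asking this of pairs suffices by
  \<open>transversal_of_direction\<close>.\<close>

definition directions :: "(real^2) set set \<Rightarrow> (real^2) set" where
  "directions S = {u. u \<noteq> 0 \<and> (\<forall>A\<in>S. \<forall>B\<in>S. \<exists>a\<in>A. \<exists>b\<in>B. cross2 (a - b) u = 0)}"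

lemma directions_antimono: "S \<subseteq> S' \<Longrightarrow> directions S' \<subseteq> directions S"
  unfolding directions_def by blast

text \<open>Nonzero parallel vectors represent the same direction, so an \<open>r\<close> parallel
  to \<open>u\<close> would also lie in \<open>directions S\<close>.\<close>

lemma cross2_directions_neq_0:
  assumes u: "u \<in> directions S" and r: "r \<notin> directions S" "r \<noteq> 0"
  shows "cross2 u r \<noteq> 0"
proof
  assume "cross2 u r = 0"
  moreover have "u \<noteq> 0" using u by (simp add: directions_def)
  ultimately obtain c where c: "r = c *\<^sub>R u" by (rule cross2_eq_0_imp_scaleR)
  have "\<exists>a\<in>A. \<exists>b\<in>B. cross2 (a - b) r = 0" if AB: "A \<in> S" "B \<in> S" for A B
  proof -
    obtain a b where "a \<in> A" "b \<in> B" "cross2 (a - b) u = 0"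
      using u AB unfolding directions_def by blast
    then show ?thesis using c by (intro bexI[of _ a] bexI[of _ b]) simp_all
  qed
  then show False using r unfolding directions_def by blast
qed

section \<open>Lines and their spans in three-space\<close>

lemma affine_planes_1_iff:
  fixes P :: "(real^2) set"
  shows "P \<in> affine_planes 1 \<longleftrightarrow> (\<exists>a b. a \<noteq> 0 \<and> P = {x. a \<bullet> x = b})"
proof
  assume "P \<in> affine_planes 1"
  then have "affine hull P = P" and dim: "aff_dim P = DIM(real^2) - 1"
    by (simp_all add: affine_planes_def)
  then show "\<exists>a b. a \<noteq> 0 \<and> P = {x. a \<bullet> x = b}"
    using dim[unfolded aff_dim_eq_hyperplane] by (simp only:)
next
  assume "\<exists>a b. a \<noteq> 0 \<and> P = {x. a \<bullet> x = b}"
  then show "P \<in> affine_planes 1"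
    by (auto simp: affine_planes_def affine_hyperplane)
qed

lemma affine_plane_1E:
  fixes P :: "(real^2) set"
  assumes "P \<in> affine_planes 1"
  obtains a b where "a \<noteq> 0" "P = {x. a \<bullet> x = b}"
  using assms unfolding affine_planes_1_iff by (elim exE conjE) rule

text \<open>A vector \<open>(x, t)\<close> on the right-hand side is moved to height 1 by adding a
  multiple of \<open>(p, 1)\<close>. In particular \<open>(d, 0)\<close> is in the span exactly when
  \<open>a \<bullet> d = 0\<close>, which is how the direction of a line is read off below.\<close>

lemma plane_span_hyperplane:
  fixes a :: "'a::euclidean_space"
  assumes "a \<noteq> 0"
  shows "plane_span {x. a \<bullet> x = b} = {z. (a, - b) \<bullet> z = 0}"
proof
  show "plane_span {x. a \<bullet> x = b} \<subseteq> {z. (a, - b) \<bullet> z = 0}"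
    unfolding plane_span_def
    by (rule span_minimal) (auto simp: subspace_hyperplane)
  define p where "p = (b / (a \<bullet> a)) *\<^sub>R a"
  have p: "a \<bullet> p = b" using assms by (simp add: p_def)
  have line: "(x, 1) \<in> plane_span {x. a \<bullet> x = b}" if "a \<bullet> x = b" for x
    unfolding plane_span_def using that by (intro span_base) auto
  show "{z. (a, - b) \<bullet> z = 0} \<subseteq> plane_span {x. a \<bullet> x = b}"
  proof clarify
    fix x t assume "(a, - b) \<bullet> (x, t) = 0"
    then have "a \<bullet> x = b * t" by simp
    then have "(x + (1 - t) *\<^sub>R p, 1) \<in> plane_span {x. a \<bullet> x = b}"
      by (intro line) (simp add: p algebra_simps)
    then have "(x + (1 - t) *\<^sub>R p, 1) - (1 - t) *\<^sub>R (p, 1) \<in> plane_span {x. a \<bullet> x = b}"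
      using line[OF p] unfolding plane_span_def by (intro span_diff span_scale)
    then show "(x, t) \<in> plane_span {x. a \<bullet> x = b}" by simp
  qed
qed

text \<open>The difference of two points of \<open>P\<close> and the vector \<open>d\<close> are
  orthogonal to the same normal, hence parallel.\<close>

lemma directions_of_transversal:
  assumes P: "P \<in> transversals 1 S" and d: "(d, 0) \<in> plane_span P" "d \<noteq> 0"
  shows "d \<in> directions S"
proof -
  have "P \<in> affine_planes 1" using P by (simp add: transversals_def)
  then obtain a b where ab: "a \<noteq> 0" "P = {x. a \<bullet> x = b}"
    by (rule affine_plane_1E)
  have ad: "a \<bullet> d = 0" using d(1) ab by (simp add: plane_span_hyperplane)
  have "\<exists>x\<in>A. \<exists>y\<in>B. cross2 (x - y) d = 0" if AB: "A \<in> S" "B \<in> S" for A B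
  proof -
    have "P \<inter> A \<noteq> {}" "P \<inter> B \<noteq> {}" using P AB by (simp_all add: transversals_def)
    then obtain x y where xy: "x \<in> A" "y \<in> B" "x \<in> P" "y \<in> P" by blast
    then have "cross2 (x - y) d = 0"
      using ab ad by (intro orthogonal_to_both_imp_cross2_0[of a]) (auto simp: inner_diff_right)
    then show ?thesis using xy by blast
  qed
  then show ?thesis using d by (simp add: directions_def)
qed

lemma affine_plane_1_direction:
  fixes P :: "(real^2) set"
  assumes "P \<in> affine_planes 1"
  obtains d where "d \<noteq> 0" "(d, 0) \<in> plane_span P"
proof -
  obtain a b where ab: "a \<noteq> 0" "P = {x. a \<bullet> x = b}"
    by (rule affine_plane_1E[OF assms])
  moreover have "a \<bullet> rot a = 0" by (simp add: inner_2)
  ultimately have "(rot a, 0) \<in> plane_span P" "rot a \<noteq> 0"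
    by (simp_all add: plane_span_hyperplane)
  then show ?thesis using that by blast
qed

text \<open>The projections along \<open>u\<close> are pairwise intersecting intervals. Helly's
  theorem on the line gives them a common value \<open>\<beta>\<close>, and the fibre over it is the
  transversal.\<close>

lemma transversal_of_direction:
  assumes fin: "finite S" and mem: "\<And>A. A \<in> S \<Longrightarrow> A \<noteq> {} \<and> convex A"
    and u: "u \<in> directions S"
  obtains P where "P \<in> transversals 1 S" "(u, 0) \<in> plane_span P"
proof -
  have u0: "u \<noteq> 0" using u by (simp add: directions_def)
  define \<F> where "\<F> = (\<lambda>A. (\<lambda>x. rot u \<bullet> x) ` A) ` S"
  have conv: "\<forall>I\<in>\<F>. convex I"
    using mem unfolding \<F>_def by (auto intro!: convex_linear_image linearI simp: inner_add_right)
  have meet: "I \<inter> J \<noteq> {}" if "I \<in> \<F>" "J \<in> \<F>" for I J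
  proof -
    obtain A B where AB: "A \<in> S" "B \<in> S" "I = (\<lambda>x. rot u \<bullet> x) ` A" "J = (\<lambda>x. rot u \<bullet> x) ` B"
      using \<open>I \<in> \<F>\<close> \<open>J \<in> \<F>\<close> unfolding \<F>_def by (elim imageE)
    then obtain x y where xy: "x \<in> A" "y \<in> B" "cross2 (x - y) u = 0"
      using u unfolding directions_def by blast
    then have "rot u \<bullet> x = rot u \<bullet> y" by (simp add: inner_rot cross2_diff)
    then have "rot u \<bullet> x \<in> I \<inter> J" using AB xy by (metis IntI imageI)
    then show ?thesis by blast
  qed
  have "\<Inter>\<F> \<noteq> {}"
  \<comment> \<open>Helly's theorem needs at least two sets, while distinct members may have equal
    projections; smaller families are treated directly.\<close>
  proof (cases "card \<F> \<ge> 2")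
    case True
    show ?thesis
    proof (rule Helly[OF _ conv])
      show "\<Inter>t \<noteq> {}" if t: "t \<subseteq> \<F>" "card t = DIM(real) + 1" for t
      proof -
        have "card t = 2" using t(2) by simp
        then obtain I J where "t = {I, J}" by (auto simp: card_2_iff)
        then show ?thesis using meet t(1) by simp
      qed
    qed (use True in simp)
  next
    case False
    have "finite \<F>" using fin by (simp add: \<F>_def)
    then have "\<F> = {} \<or> card \<F> = 1" using False card_0_eq[of \<F>] by linarith
    then show ?thesis
    proof
      assume "card \<F> = 1"
      then obtain I where "\<F> = {I}" by (rule card_1_singletonE)
      then show ?thesis using meet by auto
    qed simp
  qed
  then obtain \<beta> where "\<forall>I\<in>\<F>. \<beta> \<in> I" by blast
  then have \<beta>: "\<beta> \<in> (\<lambda>x. rot u \<bullet> x) ` A" if "A \<in> S" for A using that unfolding \<F>_def by blast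
  show ?thesis
  proof
    show "{x. rot u \<bullet> x = \<beta>} \<in> transversals 1 S"
      unfolding transversals_def
    proof (intro CollectI conjI ballI)
      show "{x. rot u \<bullet> x = \<beta>} \<in> affine_planes 1"
        unfolding affine_planes_1_iff using u0 by (intro exI[of _ "rot u"] exI[of _ \<beta>]) simp
    qed (use \<beta> in blast)
    show "(u, 0) \<in> plane_span {x. rot u \<bullet> x = \<beta>}"
      using u0 plane_span_hyperplane[of "rot u" \<beta>] by (simp add: inner_2[of "rot u" u])
  qed
qed

section \<open>Open sets in the space of lines\<close>

text \<open>Openness in the quotient topology is tested on frames. There the direction is given by
  the continuous expression \<open>\<delta>\<close>, so the set in question pulls back to the
  preimage of \<open>C\<close>.\<close>

lemma openin_line_directions:
  fixes C :: "(real^2) set"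
  assumes C: "open C" "0 \<notin> C" and scale: "\<And>d c. d \<in> C \<Longrightarrow> c \<noteq> 0 \<Longrightarrow> c *\<^sub>R d \<in> C"
  shows "openin (affine_planes_topology 1) {P \<in> affine_planes 1. \<exists>d\<in>C. (d, 0) \<in> plane_span P}"
proof -
  \<comment> \<open>The condition on \<open>snd z\<close> excludes the horizontal plane, which
    contains every \<open>(d, 0)\<close> but is not the span of a line.\<close>
  define U :: "((real^2) \<times> real) set set"
    where "U = {V \<in> grassmannian 2. (\<exists>z\<in>V. snd z \<noteq> 0) \<and> (\<exists>d\<in>C. (d, 0) \<in> V)}"
  \<comment> \<open>\<open>\<delta> v\<close> spans the horizontal part of the plane with frame \<open>v\<close>, unless that plane is horizontal,
    in which case \<open>\<delta> v = 0\<close>.\<close>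
  define \<delta> :: "(nat \<Rightarrow> (real^2) \<times> real) \<Rightarrow> real^2"
    where "\<delta> v = snd (v 1) *\<^sub>R fst (v 0) - snd (v 0) *\<^sub>R fst (v 1)" for v
  have eq: "span (v ` {..<2}) \<in> U \<longleftrightarrow> \<delta> v \<in> C" if v: "v \<in> topspace (frame_topology 2)" for v
  proof -
    have im: "v ` {..<2} = {v 0, v 1}" by (auto simp: lessThan_nat_numeral lessThan_Suc)
    have "inj_on v {..<2}" "independent (v ` {..<2})"
      using v by (simp_all add: frame_topology_def)
    then have "dim (span (v ` {..<2})) = 2"
      by (simp add: dim_eq_card_independent card_image)
    then have gr: "span (v ` {..<2}) \<in> grassmannian 2"
      by (simp add: grassmannian_def)
    have mem: "z \<in> span (v ` {..<2}) \<longleftrightarrow> (\<exists>\<alpha> \<beta>. z = \<alpha> *\<^sub>R v 0 + \<beta> *\<^sub>R v 1)" for z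
      unfolding im span_insert span_singleton by (auto simp: algebra_simps)
    show ?thesis
    proof
      assume "span (v ` {..<2}) \<in> U"
      then obtain z d where z: "z \<in> span (v ` {..<2})" "snd z \<noteq> 0"
        and d: "d \<in> C" "(d, 0) \<in> span (v ` {..<2})"
        unfolding U_def by blast
      have t: "snd (v 0) \<noteq> 0 \<or> snd (v 1) \<noteq> 0" using z mem by auto
      obtain \<alpha> \<beta> where ab: "(d, 0) = \<alpha> *\<^sub>R v 0 + \<beta> *\<^sub>R v 1" using d mem by blast
      have d_eq: "d = \<alpha> *\<^sub>R fst (v 0) + \<beta> *\<^sub>R fst (v 1)" and s_eq: "\<alpha> * snd (v 0) + \<beta> * snd (v 1) = 0"
        using arg_cong[OF ab, of fst] arg_cong[OF ab, of snd] by simp_all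
      have 1: "snd (v 1) *\<^sub>R d = \<alpha> *\<^sub>R \<delta> v"
      proof -
        have "\<alpha> *\<^sub>R \<delta> v = snd (v 1) *\<^sub>R (\<alpha> *\<^sub>R fst (v 0)) - (\<alpha> * snd (v 0)) *\<^sub>R fst (v 1)"
          by (simp add: \<delta>_def algebra_simps)
        also have "\<alpha> * snd (v 0) = - (\<beta> * snd (v 1))" using s_eq by simp
        finally show ?thesis by (simp add: d_eq algebra_simps)
      qed
      have 2: "snd (v 0) *\<^sub>R d = (- \<beta>) *\<^sub>R \<delta> v"
      proof -
        have "(- \<beta>) *\<^sub>R \<delta> v = snd (v 0) *\<^sub>R (\<beta> *\<^sub>R fst (v 1)) - (\<beta> * snd (v 1)) *\<^sub>R fst (v 0)"
          by (simp add: \<delta>_def algebra_simps)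
        also have "\<beta> * snd (v 1) = - (\<alpha> * snd (v 0))" using s_eq by simp
        finally show ?thesis by (simp add: d_eq algebra_simps)
      qed
      \<comment> \<open>One of the two heights is nonzero, so \<open>\<delta> v\<close> is a nonzero
        multiple of \<open>d\<close>, and \<open>C\<close> is closed under such multiples.\<close>
      obtain s r where sr: "s \<noteq> 0" "s *\<^sub>R d = r *\<^sub>R \<delta> v" using 1 2 t by blast
      then have "s *\<^sub>R d \<in> C" using scale d by blast
      then have "r \<noteq> 0" using sr C by auto
      have "\<delta> v = inverse r *\<^sub>R (s *\<^sub>R d)" using sr \<open>r \<noteq> 0\<close> by simp
      then show "\<delta> v \<in> C" using scale[OF \<open>s *\<^sub>R d \<in> C\<close>] \<open>r \<noteq> 0\<close> by simp
    next
      assume dC: "\<delta> v \<in> C"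
      have "(\<delta> v, 0) = snd (v 1) *\<^sub>R v 0 + (- snd (v 0)) *\<^sub>R v 1"
        by (simp add: \<delta>_def prod_eq_iff)
      then have "(\<delta> v, 0) \<in> span (v ` {..<2})" using mem by blast
      moreover have "\<delta> v \<noteq> 0" using dC C by auto
      then have "snd (v 0) \<noteq> 0 \<or> snd (v 1) \<noteq> 0" by (auto simp: \<delta>_def)
      then have "\<exists>z\<in>span (v ` {..<2}). snd z \<noteq> 0"
        unfolding im by (auto intro: span_base bexI[of _ "v 0"] bexI[of _ "v 1"])
      ultimately show "span (v ` {..<2}) \<in> U" using gr dC unfolding U_def by blast
    qed
  qed
  have cont: "continuous_map (frame_topology 2) euclidean \<delta>"
  proof -
    have proj: "continuous_map (frame_topology 2) euclidean (\<lambda>v. v i :: (real^2) \<times> real)" if "i < 2" for i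
      unfolding frame_topology_def using that
      by (intro continuous_map_from_subtopology continuous_map_product_projection) simp
    \<comment> \<open>Continuity is restated through limits, where the rules for products and
      differences apply to \<open>\<delta>\<close>.\<close>
    have "((\<lambda>v. v i) \<longlongrightarrow> w i) (atin (frame_topology 2) w)"
      if "i < 2" "w \<in> topspace (frame_topology 2)" for i and w :: "nat \<Rightarrow> (real^2) \<times> real"
      using proj[OF that(1)] that(2) by (simp add: continuous_map_atin)
    then show ?thesis
      unfolding \<delta>_def continuous_map_atin limitin_canonical_iff
      by (intro ballI tendsto_intros) simp_all
  qed
  have "{v \<in> topspace (frame_topology 2). span (v ` {..<2}) \<in> U} =
        {v \<in> topspace (frame_topology 2). \<delta> v \<in> C}"
    using eq by blast
  also have "openin (frame_topology 2) \<dots>"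
    using openin_continuous_map_preimage[OF cont] C by simp
  finally have "openin (grassmannian_topology 2) U"
    unfolding openin_grassmannian_topology by (auto simp: U_def)
  moreover have "{P \<in> affine_planes 1. \<exists>d\<in>C. (d, 0) \<in> plane_span P} = plane_span -` U \<inter> affine_planes 1"
  proof -
    \<comment> \<open>The span of a line contains a vector of height 1, so it satisfies the extra
      condition in \<open>U\<close>.\<close>
    have "plane_span P \<in> grassmannian 2 \<and> (\<exists>z\<in>plane_span P. snd z \<noteq> 0)"
      if "P \<in> affine_planes 1" for P :: "(real^2) set"
    proof -
      obtain a b where ab: "a \<noteq> 0" "P = {x. a \<bullet> x = b}"
        using \<open>P \<in> affine_planes 1\<close> by (rule affine_plane_1E)
      then have "dim (plane_span P) = 2"
        using dim_hyperplane[of "(a, -b)"] by (simp add: plane_span_hyperplane zero_prod_def)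
      moreover have "(b / (a \<bullet> a)) *\<^sub>R a \<in> P" using ab by simp
      then have "((b / (a \<bullet> a)) *\<^sub>R a, 1) \<in> plane_span P"
        unfolding plane_span_def by (intro span_base) simp
      ultimately show ?thesis
        unfolding grassmannian_def by (auto simp: plane_span_def intro!: bexI)
    qed
    then show ?thesis unfolding U_def by blast
  qed
  ultimately show ?thesis
    unfolding affine_planes_topology_def openin_pullback_topology by (auto simp: numeral_2_eq_2)
qed

text \<open>The sign condition says that, on the projective line, the directions \<open>r\<close> and \<open>s\<close> outside
  the set do not separate the directions \<open>u\<close> and \<open>v\<close> in it.\<close>

definition nonseparating :: "(real^2) set \<Rightarrow> bool" where
  "nonseparating D \<longleftrightarrow> (\<forall>u\<in>D. \<forall>v\<in>D. \<forall>r s. r \<noteq> 0 \<and> s \<noteq> 0 \<and> r \<notin> D \<and> s \<notin> D \<longrightarrow>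
      0 < (cross2 u r * cross2 u s) * (cross2 v r * cross2 v s))"

text \<open>The quadratic form \<open>\<rho>\<close> vanishes only on multiples of \<open>r\<close>
  and \<open>s\<close>, so it has a sign on each transversal direction. If both signs occurred, the
  transversals would split into two nonempty open sets.\<close>

lemma nonseparating_directions_of_connected:
  assumes fin: "finite T" and mem: "\<And>A. A \<in> T \<Longrightarrow> A \<noteq> {} \<and> convex A"
    and conn: "connected_space (transversal_space 1 T)"
  shows "nonseparating (directions T)"
proof (rule ccontr)
  assume "\<not> ?thesis"
  then obtain u v r s where uv: "u \<in> directions T" "v \<in> directions T"
    and rs: "r \<noteq> 0" "s \<noteq> 0" "r \<notin> directions T" "s \<notin> directions T"
    and neg: "\<not> 0 < (cross2 u r * cross2 u s) * (cross2 v r * cross2 v s)"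
    unfolding nonseparating_def by blast
  define \<rho> where "\<rho> d = cross2 d r * cross2 d s" for d
  have nz: "\<rho> d \<noteq> 0" if "d \<in> directions T" for d
    using that rs cross2_directions_neq_0 unfolding \<rho>_def by simp
  have \<rho>_scale: "\<rho> (c *\<^sub>R d) = c\<^sup>2 * \<rho> d" for c d
    by (simp add: \<rho>_def power2_eq_square)
  have \<rho>_cont: "continuous_on UNIV \<rho>"
    unfolding \<rho>_def cross2_def by (intro continuous_intros continuous_on_component)
  \<comment> \<open>Scaling \<open>d\<close> multiplies \<open>\<rho> d\<close> by a square, so its
    sign depends on the line only; \<open>\<epsilon>\<close> is 1 or -1 and selects the
    sign.\<close>
  define L where "L \<epsilon> = {P \<in> affine_planes 1. \<exists>d\<in>{d. 0 < \<epsilon> * \<rho> d}. (d, 0) \<in> plane_span P}" for \<epsilon> :: real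
  have L_open: "openin (affine_planes_topology 1) (L \<epsilon>)" for \<epsilon>
    unfolding L_def
  proof (rule openin_line_directions)
    show "open {d. 0 < \<epsilon> * \<rho> d}"
      by (intro open_Collect_less continuous_intros \<rho>_cont)
    show "0 \<notin> {d. 0 < \<epsilon> * \<rho> d}" by (simp add: \<rho>_def cross2_def)
    show "c *\<^sub>R d \<in> {d. 0 < \<epsilon> * \<rho> d}" if "d \<in> {d. 0 < \<epsilon> * \<rho> d}" "c \<noteq> 0" for d c
    proof -
      have "0 < c\<^sup>2 * (\<epsilon> * \<rho> d)" using that by simp
      then show ?thesis by (simp add: \<rho>_scale mult.left_commute)
    qed
  qed
  let ?X = "transversal_space 1 T"
  have top: "topspace ?X \<subseteq> transversals 1 T" by (simp add: transversal_space_def)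
  define E where "E \<epsilon> = L \<epsilon> \<inter> transversals 1 T" for \<epsilon>
  have E_open: "openin ?X (E \<epsilon>)" for \<epsilon>
    using L_open unfolding E_def transversal_space_def by (auto simp: openin_subtopology)
  have tr: "transversals 1 T \<subseteq> affine_planes 1" by (auto simp: transversals_def)
  have cover: "topspace ?X \<subseteq> E 1 \<union> E (-1)"
  proof
    fix P assume "P \<in> topspace ?X"
    then have P: "P \<in> transversals 1 T" "P \<in> affine_planes 1" using top tr by blast+
    obtain d where d: "d \<noteq> 0" "(d, 0) \<in> plane_span P" using affine_plane_1_direction[OF P(2)] .
    then have "\<rho> d \<noteq> 0" using nz directions_of_transversal P by blast
    then have "0 < 1 * \<rho> d \<or> 0 < (-1) * \<rho> d" by auto
    then show "P \<in> E 1 \<union> E (-1)" using d P unfolding E_def L_def by blast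
  qed
  have disj: "E 1 \<inter> E (-1) = {}"
  proof (rule ccontr)
    assume "E 1 \<inter> E (-1) \<noteq> {}"
    then obtain P d d' where P: "P \<in> affine_planes 1"
      and d: "0 < \<rho> d" "(d, 0) \<in> plane_span P" "0 > \<rho> d'" "(d', 0) \<in> plane_span P"
      unfolding E_def L_def by auto
    obtain a b where ab: "a \<noteq> 0" "P = {x. a \<bullet> x = b}"
      by (rule affine_plane_1E[OF P])
    have "cross2 d d' = 0" using d ab orthogonal_to_both_imp_cross2_0[of a d d'] by (simp add: plane_span_hyperplane)
    moreover have "d \<noteq> 0" using d by (auto simp: \<rho>_def cross2_def)
    ultimately obtain c where "d' = c *\<^sub>R d" by (rule cross2_eq_0_imp_scaleR)
    then show False using d(1,3) by (simp add: \<rho>_scale mult_less_0_iff)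
  qed
  have ne: "E \<epsilon> \<noteq> {}" if d: "d \<in> directions T" "0 < \<epsilon> * \<rho> d" for d \<epsilon>
  proof -
    obtain P where "P \<in> transversals 1 T" "(d, 0) \<in> plane_span P"
      using transversal_of_direction[OF fin mem d(1)] by blast
    then have "P \<in> E \<epsilon>" using d tr unfolding E_def L_def by blast
    then show ?thesis by blast
  qed
  \<comment> \<open>\<open>neg\<close> excludes only a positive product; it is negative because
    \<open>\<rho>\<close> does not vanish on \<open>directions T\<close>.\<close>
  have "\<rho> u * \<rho> v < 0" using neg nz[OF uv(1)] nz[OF uv(2)] unfolding \<rho>_def[symmetric]
    by (metis linorder_neqE_linordered_idom mult_eq_0_iff)
  then have "0 < 1 * \<rho> u \<and> 0 < (-1) * \<rho> v \<or> 0 < 1 * \<rho> v \<and> 0 < (-1) * \<rho> u"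
    by (auto simp: mult_less_0_iff)
  then have "E 1 \<noteq> {}" "E (-1) \<noteq> {}" using ne uv by blast+
  then show False using conn E_open cover disj unfolding connected_space_def by blast
qed

section \<open>Order of directions on the projective line\<close>

text \<open>If \<open>q\<close> were missing, then \<open>q\<close> and \<open>w\<close> would be
  two missing directions that separate \<open>p\<close> from \<open>r\<close>, or of which one
  coincides with \<open>p\<close> or \<open>r\<close>.\<close>

lemma between_in_directions:
  assumes "nonseparating D" "p \<in> D" "r \<in> D" "w \<notin> D" "w \<noteq> 0" "q \<noteq> 0"
    and "(cross2 p q * cross2 p w) * (cross2 r q * cross2 r w) \<le> 0"
  shows "q \<in> D"
  using assms unfolding nonseparating_def by force

text \<open>With \<open>w\<close> at infinity the directions become real numbers, and one of three
  numbers lies between the other two. By \<open>key\<close> the products of cross products have the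
  signs of the corresponding products of differences.\<close>

lemma one_of_three_between:
  assumes "cross2 p w \<noteq> 0" "cross2 q w \<noteq> 0" "cross2 r w \<noteq> 0"
  shows "(cross2 q p * cross2 q w) * (cross2 r p * cross2 r w) \<le> 0 \<or> (cross2 p q * cross2 p w) * (cross2 r q * cross2 r w) \<le> 0
       \<or> (cross2 p r * cross2 p w) * (cross2 q r * cross2 q w) \<le> 0"
proof -
  \<comment> \<open>the affine coordinate on the projective line that has \<open>w\<close> at infinity\<close>
  define x where "x u = (u \<bullet> w) / cross2 u w" for u
  have key: "(w \<bullet> w)\<^sup>2 * ((cross2 u v * cross2 u w) * (cross2 s v * cross2 s w)) =
      ((x u - x v) * (x s - x v)) * (cross2 u w * cross2 v w * cross2 s w)\<^sup>2"
    if "cross2 u w \<noteq> 0" "cross2 v w \<noteq> 0" "cross2 s w \<noteq> 0" for u v s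
  proof -
    have eq: "(w \<bullet> w) * cross2 u v = - ((x u - x v) * (cross2 u w * cross2 v w))" if "cross2 u w \<noteq> 0" "cross2 v w \<noteq> 0" for u v
    proof -
      have "(x u - x v) * (cross2 u w * cross2 v w) = (u \<bullet> w) * cross2 v w - (v \<bullet> w) * cross2 u w"
        using that by (simp add: x_def field_simps)
      also have "\<dots> = - ((w \<bullet> w) * cross2 u v)" by (simp add: inner_2 cross2_def algebra_simps)
      finally show ?thesis by simp
    qed
    have "(w \<bullet> w)\<^sup>2 * ((cross2 u v * cross2 u w) * (cross2 s v * cross2 s w)) =
        ((w \<bullet> w) * cross2 u v) * ((w \<bullet> w) * cross2 s v) * (cross2 u w * cross2 s w)"
      by (simp add: power2_eq_square)
    also have "\<dots> = ((x u - x v) * (x s - x v)) * (cross2 u w * cross2 v w * cross2 s w)\<^sup>2"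
      using that by (simp add: eq power2_eq_square)
    finally show ?thesis .
  qed
  have "w \<bullet> w > 0" using assms(1) by (auto simp: cross2_def)
  then have *: "(cross2 u v * cross2 u w) * (cross2 s v * cross2 s w) \<le> 0"
    if "(x u - x v) * (x s - x v) \<le> 0" "cross2 u w \<noteq> 0" "cross2 v w \<noteq> 0" "cross2 s w \<noteq> 0" for u v s
  proof -
    have "(w \<bullet> w)\<^sup>2 * ((cross2 u v * cross2 u w) * (cross2 s v * cross2 s w)) \<le> 0"
      unfolding key[OF that(2-4)] using that(1) by (simp add: mult_nonpos_nonneg)
    then show ?thesis using \<open>w \<bullet> w > 0\<close> by (simp add: mult_le_0_iff)
  qed
  have "(x q - x p) * (x r - x p) \<le> 0 \<or> (x p - x q) * (x r - x q) \<le> 0 \<or> (x p - x r) * (x q - x r) \<le> 0"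
    unfolding mult_le_0_iff by linarith
  then show ?thesis using * assms by blast
qed

section \<open>Missing directions\<close>

lemma semipairwise_disjoint_subset:
  "semipairwise_disjoint S \<Longrightarrow> T \<subseteq> S \<Longrightarrow> semipairwise_disjoint T"
  unfolding semipairwise_disjoint_def by (meson subsetD)

text \<open>Two of any three members are disjoint, hence separated by a line. Openness makes one of
  the inequalities strict, so the projections along that line are disjoint.\<close>

lemma missing_direction:
  assumes mem: "\<And>A. A \<in> S \<Longrightarrow> A \<noteq> {} \<and> open A \<and> convex A"
    and semi: "semipairwise_disjoint S" and card: "card S \<ge> 3"
  obtains w where "w \<noteq> 0" "w \<notin> directions S"
proof -
  obtain T where "T \<subseteq> S" "card T = 3" "finite T" by (rule obtain_subset_with_card_n[OF card])
  then obtain X Y Z where "T = {X, Y, Z}" and neq: "X \<noteq> Y" "X \<noteq> Z" "Y \<noteq> Z"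
    unfolding card_3_iff by (elim exE conjE)
  then have "X \<in> S" "Y \<in> S" "Z \<in> S" using \<open>T \<subseteq> S\<close> by auto
  with neq have "X \<inter> Y = {} \<or> X \<inter> Z = {} \<or> Y \<inter> Z = {}"
    using semi unfolding semipairwise_disjoint_def by simp
  then obtain A B where AB: "A \<in> S" "B \<in> S" "A \<inter> B = {}"
    using \<open>X \<in> S\<close> \<open>Y \<in> S\<close> \<open>Z \<in> S\<close> by blast
  then obtain a b where a: "a \<noteq> 0" "\<And>x. x \<in> A \<Longrightarrow> a \<bullet> x \<le> b" "\<And>x. x \<in> B \<Longrightarrow> b \<le> a \<bullet> x"
    using separating_hyperplane_sets[of A B] mem by blast
  have strict: "a \<bullet> x < b" if "x \<in> A" for x
  proof -
    have "{x. a \<bullet> x \<le> b} \<supseteq> A" using a(2) by blast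
    then have "A \<subseteq> interior {x. a \<bullet> x \<le> b}" using mem AB by (simp add: interior_maximal)
    then show ?thesis using that a(1) by (auto simp: interior_halfspace_le)
  qed
  define w where "w = - rot a"
  have rot_w: "rot w = a" by (simp add: w_def eq_2_iff)
  have "cross2 (x - y) w \<noteq> 0" if "x \<in> A" "y \<in> B" for x y
    using strict[OF that(1)] a(3)[OF that(2)] inner_rot[of w "x - y"] rot_w by (simp add: inner_diff_right)
  then have "w \<notin> directions S" using AB unfolding directions_def by blast
  moreover have "w \<noteq> 0" using a(1) by (simp add: w_def)
  ultimately show ?thesis using that by blast
qed

lemma nonseparating_directions_of_four:
  assumes four: "\<And>T. T \<subseteq> S \<Longrightarrow> card T = 4 \<Longrightarrow> nonseparating (directions T)"
    and fin: "finite S" and card: "card S \<ge> 4"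
  shows "nonseparating (directions S)"
  unfolding nonseparating_def
proof (intro ballI allI impI, elim conjE)
  fix u v r s
  assume uv: "u \<in> directions S" "v \<in> directions S" and rs: "r \<noteq> 0" "s \<noteq> 0" "r \<notin> directions S" "s \<notin> directions S"
  \<comment> \<open>A missing direction is missed by every family that contains one offending
    pair.\<close>
  have bad: "\<exists>A\<in>S. \<exists>B\<in>S. \<forall>T. A \<in> T \<longrightarrow> B \<in> T \<longrightarrow> r \<notin> directions T"
    if "r \<noteq> 0" "r \<notin> directions S" for r
    using that unfolding directions_def by blast
  obtain A B where AB: "A \<in> S" "B \<in> S" "\<And>T. A \<in> T \<Longrightarrow> B \<in> T \<Longrightarrow> r \<notin> directions T"
    using bad[OF rs(1,3)] by blast
  obtain C D where CD: "C \<in> S" "D \<in> S" "\<And>T. C \<in> T \<Longrightarrow> D \<in> T \<Longrightarrow> s \<notin> directions T"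
    using bad[OF rs(2,4)] by blast
  \<comment> \<open>The two pairs may overlap, so they are padded inside \<open>S\<close> to exactly
    four members.\<close>
  have "card {A,B,C,D} \<le> 4" by (simp add: card_insert_if)
  then obtain T where T: "{A,B,C,D} \<subseteq> T" "T \<subseteq> S" "card T = 4"
    using exists_subset_between[of "{A,B,C,D}" 4 S] AB CD fin card by auto
  then have "r \<notin> directions T" "s \<notin> directions T" "u \<in> directions T" "v \<in> directions T"
    using AB CD uv directions_antimono[OF T(2)] by auto
  then show "0 < (cross2 u r * cross2 u s) * (cross2 v r * cross2 v s)"
    using four[OF T(2,3)] rs unfolding nonseparating_def by blast
qed

subsection \<open>The inductive step\<close>

lemma six_point_cycle:
  fixes v :: "'a \<Rightarrow> 'a set"
  assumes X: "card X = 6"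
    and ne: "\<And>j. j \<in> X \<Longrightarrow> v j \<noteq> {} \<and> j \<notin> v j"
    and tr: "\<And>i j k. i \<in> X \<Longrightarrow> j \<in> X \<Longrightarrow> k \<in> X \<Longrightarrow> i \<noteq> j \<Longrightarrow> i \<noteq> k \<Longrightarrow> j \<noteq> k \<Longrightarrow>
       v i \<subseteq> {j,k} \<or> v j \<subseteq> {i,k} \<or> v k \<subseteq> {i,j}"
  shows "\<exists>i\<in>X. \<exists>j\<in>X. \<exists>k\<in>X. i \<noteq> j \<and> i \<noteq> k \<and> j \<noteq> k \<and> v i = {j} \<and> v j = {k} \<and> v k = {i}"
proof -
  \<comment> \<open>Selecting \<open>f j \<in> v j\<close> gives a graph with at most six edges that meets every triple.
    By Mantel's theorem for its complement it is a pair of triangles, whatever the selection.\<close>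
  have fin: "finite X" using X by (metis card.infinite zero_neq_numeral)
  define sel where "sel f \<longleftrightarrow> (\<forall>j\<in>X. f j \<in> v j)" for f :: "'a \<Rightarrow> 'a"
  define e where "e f x y \<longleftrightarrow> f x = y \<or> f y = x" for f :: "'a \<Rightarrow> 'a" and x y
  have hit: "e f x y \<or> e f x z \<or> e f y z"
    if "sel f" "x \<in> X" "y \<in> X" "z \<in> X" "x \<noteq> y" "x \<noteq> z" "y \<noteq> z" for f x y z
    using tr[of x y z] that unfolding sel_def e_def by blast
  \<comment> \<open>Four points not adjacent to \<open>x\<close> would be pairwise adjacent by
    \<open>hit\<close>. That takes six edges, but every edge inside \<open>W'\<close> has the form
    \<open>{y, f y}\<close> for one of its four points.\<close>
  have nonnbrs: "\<exists>w\<in>W. e f x w"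
    if f: "sel f" and x: "x \<in> X" and W: "W \<subseteq> X - {x}" and cW: "card W \<ge> 4" for f x W
  proof (rule ccontr)
    assume no: "\<not> ?thesis"
    obtain W' where W': "W' \<subseteq> W" "card W' = 4" "finite W'"
      using obtain_subset_with_card_n[OF cW] by metis
    have "{B. B \<subseteq> W' \<and> card B = 2} \<subseteq> (\<lambda>y. {y, f y}) ` W'"
    proof clarify
      fix B assume B: "B \<subseteq> W'" "card B = 2"
      then obtain y z where yz: "B = {y,z}" "y \<noteq> z" by (meson card_2_iff)
      have "e f y z"
        using hit[OF f x, of y z] B yz no W W' by blast
      then show "B \<in> (\<lambda>y. {y, f y}) ` W'"
        using B yz unfolding e_def by auto
    qed
    then have "card {B. B \<subseteq> W' \<and> card B = 2} \<le> card W'"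
      using W'(3) surj_card_le by blast
    then show False using n_subsets[OF W'(3), of 2] W'(2) by (simp add: choose_two)
  qed
  \<comment> \<open>A point outside the image is adjacent at most to its own value, which leaves
    four points contradicting \<open>nonnbrs\<close>. So \<open>f\<close> maps onto \<open>X\<close>
    and is injective by finiteness.\<close>
  have perm: "f ` X = X \<and> inj_on f X" if f: "sel f" for f
  proof -
    have "X \<subseteq> f ` X"
    proof
      fix x assume x: "x \<in> X"
      have "card (X - {x, f x}) \<ge> 4"
        using card_Diff_subset_Int[of X "{x, f x}"] card_mono[of "{x, f x}" "X \<inter> {x, f x}"] X
          card_insert_le_m1[of 2 "{f x}" x] by auto
      from nonnbrs[OF f x _ this] show "x \<in> f ` X"
        unfolding e_def by auto
    qed
    moreover have "card (f ` X) \<le> card X" using fin card_image_le by blast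
    ultimately have "f ` X = X"
      using fin by (metis card_seteq finite_imageI)
    then show ?thesis using fin eq_card_imp_inj_on by metis
  qed
  define f where "f j = (SOME a. a \<in> v j)" for j
  have f: "sel f" unfolding sel_def f_def using ne some_in_eq by blast
  \<comment> \<open>Changing the value at \<open>j\<close> to another \<open>b \<in> v j\<close>
    gives a selection again, but \<open>b\<close> is already the value at another point, so
    injectivity fails.\<close>
  have uniq: "v j = {f j}" if j: "j \<in> X" for j
  proof -
    have "b = f j" if b: "b \<in> v j" for b
    proof (rule ccontr)
      assume neq: "b \<noteq> f j"
      define h where "h = f(j := b)"
      have h: "sel h" using f b unfolding sel_def h_def by simp
      have "b \<in> X" using perm[OF h] j unfolding h_def by force
      then have "b \<in> f ` X" using perm[OF f] by simp
      then obtain i where i: "i \<in> X" "f i = b" by blast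
      then have "i \<noteq> j" using neq by auto
      then show False using perm[OF h] i j unfolding h_def inj_on_def by auto
    qed
    then show ?thesis using f j unfolding sel_def by blast
  qed
  have inj: "y = z" if "f y = f z" "y \<in> X" "z \<in> X" for y z
    using perm[OF f] that unfolding inj_on_def by blast
  obtain x where x: "x \<in> X" using X by fastforce
  have "x \<in> f ` X" using perm[OF f] x by simp
  then obtain u where u: "u \<in> X" "f u = x" by blast
  have nofix: "f j \<noteq> j" if "j \<in> X" for j using f ne that unfolding sel_def by metis
  have fx: "f x \<in> X" "f x \<noteq> x" "u \<noteq> x" using perm[OF f] x u nofix[of x] nofix[of u] by auto
  \<comment> \<open>Otherwise \<open>x\<close> lies on a 2-cycle, its only neighbour is
    \<open>u\<close>, and four non-neighbours remain.\<close>
  have "f x \<noteq> u"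
  proof
    assume "f x = u"
    have "card (X - {x, u}) \<ge> 4" using X x u fx fin by (auto simp: card_Diff_subset card_insert_if)
    from nonnbrs[OF f x _ this] obtain w where "w \<in> X - {x,u}" "e f x w" by blast
    then show False using inj[of w u] u x \<open>f x = u\<close> unfolding e_def by auto
  qed
  then have "card (X - {x, f x, u}) = 3" using X x u fx fin by (simp add: card_Diff_subset)
  then obtain a b c where abc: "X - {x, f x, u} = {a,b,c}" "a \<noteq> b" "a \<noteq> c" "b \<noteq> c"
    unfolding card_3_iff by blast
  then have inX: "a \<in> X" "b \<in> X" "c \<in> X" and out: "a \<notin> {x, f x, u}" "b \<notin> {x, f x, u}" "c \<notin> {x, f x, u}"
    by blast+
  \<comment> \<open>Only \<open>f x\<close> and \<open>u\<close> are adjacent to \<open>x\<close>.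
    Hence \<open>hit\<close> makes the other three points pairwise adjacent, and the injective
    \<open>f\<close> permutes them in a 3-cycle.\<close>
  have nx: "\<not> e f x a" "\<not> e f x b" "\<not> e f x c"
    using inj[OF _ _ u(1)] u(2) out inX unfolding e_def by auto
  have "e f a b" "e f a c" "e f b c"
    using hit[OF f x] inX out nx abc by blast+
  then have "f a = b \<and> f b = c \<and> f c = a \<or> f a = c \<and> f c = b \<and> f b = a"
    using abc(2-4) inj[OF _ inX(1,2)] inj[OF _ inX(1,3)] inj[OF _ inX(2,3)] unfolding e_def by auto
  then show ?thesis
  proof (elim disjE conjE)
    assume "f a = b" "f b = c" "f c = a"
    then show ?thesis using uniq inX abc(2-4)
      by (intro bexI[of _ a] bexI[of _ b] bexI[of _ c]) auto
  next
    assume "f a = c" "f c = b" "f b = a"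
    then show ?thesis using uniq inX abc(2-4)
      by (intro bexI[of _ a] bexI[of _ c] bexI[of _ b]) auto
  qed
qed

section \<open>Enlarging a family by one member\<close>

lemma directions_step:
  assumes fin: "finite S" and card: "card S \<ge> 6"
    and mem: "\<And>A. A \<in> S \<Longrightarrow> A \<noteq> {} \<and> open A \<and> convex A"
    and semi: "semipairwise_disjoint S"
    and four: "\<And>T. T \<subseteq> S \<Longrightarrow> card T \<ge> 4 \<Longrightarrow> nonseparating (directions T)"
    and drop: "\<And>A. A \<in> S \<Longrightarrow> directions (S - {A}) \<noteq> {}"
  shows "directions S \<noteq> {}"
proof (rule ccontr)
  assume empty: "\<not> directions S \<noteq> {}"
  have "\<exists>p. \<forall>A\<in>S. p A \<in> directions (S - {A})"
    using drop by (intro bchoice) blast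
  then obtain p where p: "p A \<in> directions (S - {A})" if "A \<in> S" for A by blast
  have p0: "p A \<noteq> 0" if "A \<in> S" for A using p[OF that] by (simp add: directions_def)
  define v where "v A = {B \<in> S. \<not> (\<exists>a\<in>A. \<exists>b\<in>B. cross2 (a - b) (p A) = 0)}" for A
  have self: "\<exists>a\<in>A. \<exists>b\<in>A. cross2 (a - b) u = 0" if "A \<in> S" for A u
  proof -
    obtain a where "a \<in> A" using mem[OF \<open>A \<in> S\<close>] by blast
    then show ?thesis by (intro bexI[of _ a]) (simp_all add: cross2_def)
  qed
  \<comment> \<open>Along \<open>p A\<close> all projections of members other than \<open>A\<close>
    meet pairwise, so the only possible failures involve \<open>A\<close> and are recorded in
    \<open>v A\<close>.\<close>
  have in_v: "p A \<in> directions (S - V) \<longleftrightarrow> v A \<subseteq> V" if A: "A \<in> S" "A \<notin> V" for A V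
  proof
    assume "p A \<in> directions (S - V)"
    then show "v A \<subseteq> V" using A unfolding v_def directions_def by blast
  next
    assume V: "v A \<subseteq> V"
    have 1: "\<exists>a\<in>A. \<exists>b\<in>B. cross2 (a - b) (p A) = 0" if "B \<in> S - V" for B
      using that V unfolding v_def by blast
    have 2: "\<exists>b\<in>B. \<exists>a\<in>A. cross2 (b - a) (p A) = 0" if B: "B \<in> S - V" for B
    proof -
      obtain a b where "a \<in> A" "b \<in> B" "cross2 (a - b) (p A) = 0" using 1[OF B] by blast
      then show ?thesis by (intro bexI[of _ b] bexI[of _ a]) (simp_all add: cross2_diff)
    qed
    have 3: "\<exists>b\<in>B. \<exists>c\<in>C. cross2 (b - c) (p A) = 0" if "B \<in> S - {A}" "C \<in> S - {A}" for B C
      using p[OF A(1)] that unfolding directions_def by blast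
    have "\<exists>b\<in>B. \<exists>c\<in>C. cross2 (b - c) (p A) = 0" if "B \<in> S - V" "C \<in> S - V" for B C
      using 1 2 3 that by (cases "B = A"; cases "C = A") auto
    then show "p A \<in> directions (S - V)" using p0[OF A(1)] unfolding directions_def by blast
  qed
  have v_ne: "v A \<noteq> {} \<and> A \<notin> v A" if A: "A \<in> S" for A
  proof
    show "v A \<noteq> {}" using in_v[OF A, of "{}"] empty by auto
    show "A \<notin> v A" using self[OF A] by (simp add: v_def)
  qed
  \<comment> \<open>At least three members survive the removal, enough for
    \<open>missing_direction\<close>; \<open>w\<close> then serves as the point at infinity.\<close>
  have chart: "\<exists>w. w \<noteq> 0 \<and> w \<notin> directions (S - {A,B,C})"
    if "A \<in> S" "B \<in> S" "C \<in> S" for A B C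
  proof -
    have "card (S - {A,B,C}) \<ge> card S - card {A,B,C}" by (rule diff_card_le_card_Diff) simp
    moreover have "card {A,B,C} \<le> 3" by (simp add: card_insert_if)
    ultimately have "card (S - {A,B,C}) \<ge> 3" using card by linarith
    moreover have "semipairwise_disjoint (S - {A,B,C})"
      using semipairwise_disjoint_subset[OF semi] by blast
    ultimately obtain w where "w \<noteq> 0" "w \<notin> directions (S - {A,B,C})"
      using missing_direction[of "S - {A,B,C}"] mem by blast
    then show ?thesis by blast
  qed
  \<comment> \<open>The order of the three directions depends on \<open>w\<close> and not on
    \<open>D\<close>, so \<open>D\<close> can be chosen afterwards, separately in each case.\<close>
  have middle: "(\<forall>D. nonseparating D \<and> w \<notin> D \<and> p B \<in> D \<and> p C \<in> D \<longrightarrow> p A \<in> D) \<or>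
      (\<forall>D. nonseparating D \<and> w \<notin> D \<and> p A \<in> D \<and> p C \<in> D \<longrightarrow> p B \<in> D) \<or>
      (\<forall>D. nonseparating D \<and> w \<notin> D \<and> p A \<in> D \<and> p B \<in> D \<longrightarrow> p C \<in> D)"
    if ABC: "A \<in> S" "B \<in> S" "C \<in> S" and w: "w \<noteq> 0" "w \<notin> directions (S - {A,B,C})" for A B C w
  proof -
    have "p X \<in> directions (S - {A,B,C})" if "X \<in> {A,B,C}" for X
      using p[of X] that ABC directions_antimono[of "S - {A,B,C}" "S - {X}"] by blast
    then have "cross2 (p A) w \<noteq> 0" "cross2 (p B) w \<noteq> 0" "cross2 (p C) w \<noteq> 0"
      using cross2_directions_neq_0[OF _ w(2,1)] by blast+
    from one_of_three_between[OF this] show ?thesis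
    proof (elim disjE)
      assume le: "(cross2 (p B) (p A) * cross2 (p B) w) * (cross2 (p C) (p A) * cross2 (p C) w) \<le> 0"
      have "\<forall>D. nonseparating D \<and> w \<notin> D \<and> p B \<in> D \<and> p C \<in> D \<longrightarrow> p A \<in> D"
        using between_in_directions[OF _ _ _ _ w(1) p0[OF ABC(1)] le] by blast
      then show ?thesis by blast
    next
      assume le: "(cross2 (p A) (p B) * cross2 (p A) w) * (cross2 (p C) (p B) * cross2 (p C) w) \<le> 0"
      have "\<forall>D. nonseparating D \<and> w \<notin> D \<and> p A \<in> D \<and> p C \<in> D \<longrightarrow> p B \<in> D"
        using between_in_directions[OF _ _ _ _ w(1) p0[OF ABC(2)] le] by blast
      then show ?thesis by blast
    next
      assume le: "(cross2 (p A) (p C) * cross2 (p A) w) * (cross2 (p B) (p C) * cross2 (p B) w) \<le> 0"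
      have "\<forall>D. nonseparating D \<and> w \<notin> D \<and> p A \<in> D \<and> p B \<in> D \<longrightarrow> p C \<in> D"
        using between_in_directions[OF _ _ _ _ w(1) p0[OF ABC(3)] le] by blast
      then show ?thesis by blast
    qed
  qed
  \<comment> \<open>Removing two of at least six members leaves the four that \<open>four\<close>
    requires.\<close>
  have ns: "nonseparating (directions (S - V))" if "card V \<le> 2" "V \<subseteq> S" for V
    using four[of "S - V"] card fin that card_Diff_subset[of V S] finite_subset[of V S] by auto
  have missing_mono: "w \<notin> directions (S - V)" if "w \<notin> directions (S - W)" "V \<subseteq> W" for w V W
    using that directions_antimono[of "S - W" "S - V"] by blast
  have triple: "v A \<subseteq> {B,C} \<or> v B \<subseteq> {A,C} \<or> v C \<subseteq> {A,B}"
    if ABC: "A \<in> S" "B \<in> S" "C \<in> S" "A \<noteq> B" "A \<noteq> C" "B \<noteq> C" for A B C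
  proof -
    obtain w where w: "w \<noteq> 0" "w \<notin> directions (S - {A,B,C})" using chart ABC by blast
    have D: "nonseparating (directions (S - {X,Y})) \<and> w \<notin> directions (S - {X,Y})
        \<and> p X \<in> directions (S - {X,Y}) \<and> p Y \<in> directions (S - {X,Y})"
      if "{X,Y} \<subseteq> {A,B,C}" for X Y
    proof (intro conjI)
      show "nonseparating (directions (S - {X,Y}))" using ABC that by (intro ns) (auto simp: card_insert_if)
      show "w \<notin> directions (S - {X,Y})" using missing_mono w(2) that by blast
      show "p X \<in> directions (S - {X,Y})" "p Y \<in> directions (S - {X,Y})"
        using p[of X] p[of Y] that ABC directions_antimono[of "S - {X,Y}" "S - {X}"]
          directions_antimono[of "S - {X,Y}" "S - {Y}"] by blast+
    qed
    \<comment> \<open>If \<open>p A\<close> is the middle one, it joins \<open>p B\<close> and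
      \<open>p C\<close> in the directions of \<open>S - {B,C}\<close>; the other cases are
      alike.\<close>
    have "p A \<in> directions (S - {B,C}) \<or> p B \<in> directions (S - {A,C}) \<or> p C \<in> directions (S - {A,B})"
      using middle[OF ABC(1-3) w] D[of A B] D[of A C] D[of B C] by blast
    then show ?thesis using in_v ABC by auto
  qed
  obtain X where X: "X \<subseteq> S" "card X = 6" "finite X" by (rule obtain_subset_with_card_n[OF card])
  have "\<exists>A\<in>X. \<exists>B\<in>X. \<exists>C\<in>X. A \<noteq> B \<and> A \<noteq> C \<and> B \<noteq> C \<and> v A = {B} \<and> v B = {C} \<and> v C = {A}"
  proof (rule six_point_cycle[OF X(2)])
    show "v A \<noteq> {} \<and> A \<notin> v A" if "A \<in> X" for A
      using v_ne[of A] X(1) that by blast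
    show "v A \<subseteq> {B,C} \<or> v B \<subseteq> {A,C} \<or> v C \<subseteq> {A,B}"
      if "A \<in> X" "B \<in> X" "C \<in> X" "A \<noteq> B" "A \<noteq> C" "B \<noteq> C" for A B C
      using triple[OF _ _ _ that(4-6)] X(1) that(1-3) by blast
  qed
  then obtain A B C where "A \<in> X" "B \<in> X" "C \<in> X" and neq: "A \<noteq> B" "A \<noteq> C" "B \<noteq> C"
    and cyc: "v A = {B}" "v B = {C}" "v C = {A}"
    by (elim bexE conjE)
  then have ABC: "A \<in> S" "B \<in> S" "C \<in> S" using X(1) by auto
  obtain w where w: "w \<noteq> 0" "w \<notin> directions (S - {A,B,C})" using chart ABC by blast
  have D: "nonseparating (directions (S - {Y})) \<and> w \<notin> directions (S - {Y})" if "Y \<in> {A,B,C}" for Y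
    using ns[of "{Y}"] missing_mono[OF w(2), of "{Y}"] that ABC by auto
  have inn: "p A \<in> directions (S - {B})" "p B \<in> directions (S - {C})" "p C \<in> directions (S - {A})"
    and out: "p A \<notin> directions (S - {C})" "p B \<notin> directions (S - {A})" "p C \<notin> directions (S - {B})"
    using in_v cyc ABC neq by auto
  \<comment> \<open>None of the three can be the middle one: the directions of
    \<open>S - {C}\<close> contain \<open>p B\<close> and \<open>p C\<close> but not
    \<open>p A\<close>, and the other two cases follow by cyclic shift.\<close>
  show False
    using middle[OF ABC(1-3) w] D[of A] D[of B] D[of C] inn out p[OF ABC(1)] p[OF ABC(2)] p[OF ABC(3)]
    by blast
qed

theorem theorem3p2p1:
  fixes F :: "(real ^ 2) set set"
  assumes coefficients: "\<exists>g :: 'g::ab_group_add. g \<noteq> 0"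
    and finite: "finite F"
    and size: "card F \<ge> 6"
    and members: "\<And>A. A \<in> F \<Longrightarrow> A \<noteq> {} \<and> open A \<and> convex A"
    and semipairwise: "semipairwise_disjoint F"
    and five: "\<And>F'. F' \<subseteq> F \<Longrightarrow> card F' = 5 \<Longrightarrow> transversals 1 F' \<noteq> {}"
    and four: "\<And>F'. F' \<subseteq> F \<Longrightarrow> card F' = 4 \<Longrightarrow>
                 homology_connected TYPE('g) (transversal_space 1 F')"
  shows "transversals 1 F \<noteq> {}"
proof -
  have ns4: "nonseparating (directions T)" if "T \<subseteq> F" "card T = 4" for T
  proof (rule nonseparating_directions_of_connected)
    show "finite T" using finite that(1) by (rule rev_finite_subset)
    show "A \<noteq> {} \<and> convex A" if "A \<in> T" for A using members[of A] \<open>T \<subseteq> F\<close> that by blast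
    show "connected_space (transversal_space 1 T)"
      using coefficients four[OF that] by (rule homology_connected_imp_connected_space)
  qed
  have ns: "nonseparating (directions T)" if "T \<subseteq> F" "card T \<ge> 4" for T
  proof (rule nonseparating_directions_of_four)
    show "finite T" using finite that(1) by (rule rev_finite_subset)
    show "nonseparating (directions T')" if "T' \<subseteq> T" "card T' = 4" for T'
      using ns4[of T'] \<open>T \<subseteq> F\<close> that by blast
  qed (fact that(2))
  \<comment> \<open>Induction on the size from 5 upwards: \<open>five\<close> gives the base case,
    and deleting one member leads back to the previous size.\<close>
  have "directions S \<noteq> {}" if "S \<subseteq> F" "card S = n + 5" for S n
    using that
  proof (induction n arbitrary: S)
    case 0
    then obtain P where P: "P \<in> transversals 1 S" using five[of S] by auto
    then have "P \<in> affine_planes 1" by (simp add: transversals_def)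
    then obtain d where "d \<noteq> 0" "(d, 0) \<in> plane_span P" by (rule affine_plane_1_direction)
    then show ?case using directions_of_transversal[OF P] by blast
  next
    case (Suc n)
    show ?case
    proof (rule directions_step)
      show "finite S" using finite Suc.prems(1) by (rule rev_finite_subset)
      show "card S \<ge> 6" using Suc.prems by simp
      show "A \<noteq> {} \<and> open A \<and> convex A" if "A \<in> S" for A
        using members[of A] Suc.prems(1) that by blast
      show "semipairwise_disjoint S"
        using semipairwise Suc.prems(1) by (rule semipairwise_disjoint_subset)
      show "nonseparating (directions T)" if "T \<subseteq> S" "card T \<ge> 4" for T
        using ns[of T] Suc.prems(1) that by blast
      show "directions (S - {A}) \<noteq> {}" if "A \<in> S" for A
        using that Suc.prems by (intro Suc.IH) auto
    qed
  qed
  from this[of F "card F - 5"] obtain u where u: "u \<in> directions F" using size by auto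
  have "A \<noteq> {} \<and> convex A" if "A \<in> F" for A using members[OF that] by blast
  from transversal_of_direction[OF finite this u] show ?thesis by blast
qed

end
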